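(* Let $E_J$ be a $W$-graph ideal for the weighted Coxeter system $(W,S,L)$ and let $x,y\in E_J$. (1) If $x<y$, then $P_{x,y}=L_{\frac{L(y)-L(x)}{2}}\Big(\sum_{\varphi\in\mathscr{J}(x,y)}\mathscr{R}_\varphi\Big)$. (2) If $x\leqslant y$, then $P_{x,y}=\sum_{\varphi\in\mathscr{M}(x,y)}\mathscr{R}_\varphi$ (a sum with only finitely many nonzero terms).
   Context: Setting. $(W,S)$ is a Coxeter system with length function $\ell$ and Bruhat order $\leqslant$; $\epsilon_w=(-1)^{\ell(w)}$. $\Gamma$ is a totally ordered abelian group (written additively). $\mathbb{Z}[\Gamma]$ is its group ring with $\mathbb{Z}$-basis $\{q^\gamma\mid\gamma\in\Gamma\}$, $q^\gamma q^\zeta=q^{\gamma+\zeta}$; $[q^\gamma](f)$ is the coefficient of $q^\gamma$ in $f$; $\mathsf{deg}(f)$ is the largest $\gamma$ with $[q^\gamma](f)\neq0$, $\mathsf{deg}(0)=-\infty$. The bar is the ring automorphism $q^\gamma\mapsto q^{-\gamma}$. $L:W\to\Gamma$ is a weight: $L(w)=L(s_1)+\cdots+L(s_k)$ for every reduced word $w=s_1\cdots s_k$, and $L(s)\geqslant0$ for all $s\in S$. Put $q_w=q^{L(w)}$. $\mathscr{H}$ is the Hecke algebra over $\mathbb{Z}[\Gamma]$ with basis $\{T_w\}_{w\in W}$, $T_sT_w=T_{sw}$ if $\ell(sw)>\ell(w)$, $T_sT_w=q_sT_{sw}+(q_s-1)T_w$ if $\ell(sw)<\ell(w)$, with bar involution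 (semilinear ring involution) $\overline{T_s}=q_s^{-1}T_s+(q_s^{-1}-1)$. $W$-graph ideal. $x$ is a suffix of $y$ ($x\leqslant_L y$) if $y=zx$ with $\ell(y)=\ell(z)+\ell(x)$. Let $E\subseteq W$ be an ideal of $(W,\leqslant_L)$, i.e. every suffix of an element of $E$ is in $E$. For $J\subseteq S$, $D_J=\{w\mid\ell(ws)>\ell(w)\ \forall s\in J\}$. Let $J\subseteq\{s\in S\mid\ell(xs)>\ell(x)\ \forall x\in E\}$, so $E\subseteq D_J$; write $E_J$ for $E$ with this $J$. For $y\in E_J$: $SD(y)=\{s\mid\ell(sy)<\ell(y)\}$, $SA(y)=\{s\mid\ell(sy)>\ell(y),sy\in E_J\}$, $WD(y)=\{s\mid\ell(sy)>\ell(y),sy\notin D_J\}$, $WA(y)=\{s\mid\ell(sy)>\ell(y),sy\in D_J\setminus E_J\}$. $E_J$ is a $W$-graph ideal if there is an $\mathscr{H}$-module $M(E_J,L)$, free over $\mathbb{Z}[\Gamma]$ with basis $\{\Gamma_y\mid y\in E_J\}$, such that $T_s\Gamma_y$ equals $q_s\Gamma_{sy}+(q_s-1)\Gamma_y$ if $s\in SD(y)$; $\Gamma_{sy}$ if $s\in SA(y)$; $-\Gamma_y$ if $s\in WD(y)$; $q_s\Gamma_y-\sum_{z<sy,\,z\in E_J}r^s_{z,y}\Gamma_z$ if $s\in WA(y)$, for some $r^s_{z,y}\in q_s\mathbb{Z}[\Gamma]$; and $M(E_J,L)$ admits a $\mathbb{Z}[\Gamma]$-semilinear involution $m\mapsto\overline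 m$ with $\overline{\Gamma_1}=\Gamma_1$ and $\overline{T_w\Gamma_y}=\overline{T_w}\,\overline{\Gamma_y}$ for all $w\in W,y\in E_J$. Fix such a module. $R$-polynomials. $R_{x,y}\in\mathbb{Z}[\Gamma]$ ($x,y\in E_J$) are defined by $\overline{\Gamma_y}=\sum_{x\in E_J}\epsilon_x\epsilon_yq_y^{-1}R_{x,y}\Gamma_x$. Standing facts: $R_{x,y}=0$ if $x\not\leqslant y$, $R_{x,x}=1$, and for $x\leqslant y$ all exponents $\gamma$ occurring in $R_{x,y}$ lie in the subgroup of $\Gamma$ generated by $\{L(s)\mid s\in S\}$ and satisfy $0\leqslant\gamma\leqslant L(y)-L(x)$. Kazhdan–Lusztig polynomials. $P_{x,y}\in\mathbb{Z}[\Gamma]$ ($x,y\in E_J$) is the unique family with $P_{x,y}=0$ if $x\not\leqslant y$, $P_{x,x}=1$, $\mathsf{deg}(P_{x,y})<\frac{L(y)-L(x)}2$ for $x<y$, and $q_x^{-1}q_y\overline{P_{x,y}}=\sum_{x\leqslant t\leqslant y,\,t\in E_J}R_{x,t}P_{t,y}$. Truncations. $U_\zeta(\sum_\gamma a_\gamma q^\gamma)=\sum_{\gamma>\zeta}a_\gamma q^\gamma$, $L_\zeta(\sum_\gamma a_\gamma q^\gamma)=\sum_{\gamma<\zeta}a_\gamma q^\gamma$. Halves are taken in the divisible hull of $\Gamma$: $\gamma>\zeta/2$ means $2\gamma>\zeta$. Chains. For $k\geqslant0$, $\mathscr{J}_k(x,y)$ is the set of $E_J$-chains $x=x_0<x_1<\cdots<x_{k+1}=y$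 with all $x_i\in E_J$ and $\mathscr{M}_k(x,y)$ the set of $E_J$-multichains $x=x_0\leqslant x_1\leqslant\cdots\leqslant x_{k+1}=y$ with all $x_i\in E_J$ (Bruhat order; such a (multi)chain $\varphi$ has length $\ell(\varphi)=k+1$); $\mathscr{J}(x,y)=\bigcup_{k\geqslant0}\mathscr{J}_k(x,y)$, $\mathscr{M}(x,y)=\bigcup_{k\geqslant0}\mathscr{M}_k(x,y)$. $\mathscr{R}$-polynomials. For a multichain $\varphi:x=x_0\leqslant x_1\leqslant\cdots\leqslant x_{r+1}=y$, define recursively $\mathscr{R}_\varphi=\mathscr{R}_{x,y}:=q_x^{-1}q_y\overline{R_{x,y}}$ if $r=0$, and $\mathscr{R}_\varphi=\mathscr{R}_{x,x_1}\,U_{\frac{L(y)-L(x_1)}2}\big(q_{x_1}^{-1}q_y\overline{\mathscr{R}_{\varphi'}}\big)$ if $r\geqslant1$, where $\varphi':x_1\leqslant x_2\leqslant\cdots\leqslant x_{r+1}=y$. *)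

theory Defs
  imports
    "HOL-Algebra.Multiplicative_Group"
    "HOL-Algebra.Generated_Groups"
    "HOL-Library.Poly_Mapping"
    "HOL-Library.Extended"
begin

section \<open>The group ring of a totally ordered abelian group\<close>

text \<open>
  The group ring of \<open>\<Gamma>\<close> over the integers is the type of finitely supported functions
  \<open>'g \<Rightarrow>\<^sub>0 int\<close> with the convolution product of \<^theory>\<open>HOL-Library.Poly_Mapping\<close>.
\<close>

type_synonym 'g gring = "'g \<Rightarrow>\<^sub>0 int"

definition qpow :: "'g \<Rightarrow> 'g gring" where
  "qpow \<gamma> = Poly_Mapping.single \<gamma> 1"

definition gbar :: "'g::ab_group_add gring \<Rightarrow> 'g gring" where
  "gbar f = Poly_Mapping.map_key uminus f"

text \<open>\<open>Minf\<close> plays the role of the degree \<open>-\<infinity>\<close> of the zero element.\<close>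

definition gdeg :: "'g::linorder gring \<Rightarrow> 'g extended" where
  "gdeg f = (if f = 0 then Minf else Fin (Max (Poly_Mapping.keys f)))"

text \<open>
  The two truncations at \<open>\<zeta>/2\<close>, where the half is taken in the divisible hull: the argument is
  \<open>\<zeta>\<close> itself and \<open>\<gamma> > \<zeta>/2\<close> is expressed as \<open>\<gamma> + \<gamma> > \<zeta>\<close>.
\<close>

lift_definition upper_half :: "'g::linordered_ab_group_add \<Rightarrow> 'g gring \<Rightarrow> 'g gring"
  is "\<lambda>\<zeta> f \<gamma>. if \<zeta> < \<gamma> + \<gamma> then f \<gamma> else 0"
  by (rule finite_subset) auto

lift_definition lower_half :: "'g::linordered_ab_group_add \<Rightarrow> 'g gring \<Rightarrow> 'g gring"
  is "\<lambda>\<zeta> f \<gamma>. if \<gamma> + \<gamma> < \<zeta> then f \<gamma> else 0"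
  by (rule finite_subset) auto


section \<open>Coxeter systems\<close>

definition word_prod :: "('w, 'x) monoid_scheme \<Rightarrow> 'w list \<Rightarrow> 'w" where
  "word_prod G ws = foldr (\<otimes>\<^bsub>G\<^esub>) ws \<one>\<^bsub>G\<^esub>"

text \<open>
  One application of a relator \<open>(s t)\<^bsup>m(s,t)\<^esup> = 1\<close>, where \<open>m(s,t)\<close> is the order of
  \<open>s t\<close>.  If that order is infinite, \<open>group.ord\<close> is \<open>0\<close> and the relator is the empty word, so
  that no relation is imposed.  The case \<open>s = t\<close> gives the relator \<open>s s\<close>; since these make
  the generators invertible, words in \<open>S\<close> modulo the generated congruence are exactly the
  group presented by \<open>S\<close> and these relators.
\<close>

definition coxeter_move ::
  "('w, 'x) monoid_scheme \<Rightarrow> 'w set \<Rightarrow> 'w list \<Rightarrow> 'w list \<Rightarrow> bool" where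
  "coxeter_move G S u v \<longleftrightarrow>
     (\<exists>a b s t. a \<in> lists S \<and> b \<in> lists S \<and> s \<in> S \<and> t \<in> S \<and>
        u = a @ concat (replicate (group.ord G (s \<otimes>\<^bsub>G\<^esub> t)) [s, t]) @ b \<and> v = a @ b)"

locale coxeter_system = group G for G :: "('w, 'x) monoid_scheme" (structure) +
  fixes S :: "'w set"
  assumes S_closed: "S \<subseteq> carrier G"
    and S_generates: "generate G S = carrier G"
    and S_nontrivial: "s \<in> S \<Longrightarrow> s \<noteq> \<one>"
    and S_involution: "s \<in> S \<Longrightarrow> s \<otimes> s = \<one>"
    and presentation: "\<lbrakk>u \<in> lists S; v \<in> lists S; word_prod G u = word_prod G v\<rbrakk>
      \<Longrightarrow> equivclp (coxeter_move G S) u v"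
begin

definition len :: "'w \<Rightarrow> nat" where
  "len w = (LEAST k. \<exists>ws \<in> lists S. word_prod G ws = w \<and> length ws = k)"

definition reduced_word :: "'w list \<Rightarrow> 'w \<Rightarrow> bool" where
  "reduced_word ws w \<longleftrightarrow> ws \<in> lists S \<and> word_prod G ws = w \<and> length ws = len w"

definition refls :: "'w set" where
  "refls = {g \<otimes> s \<otimes> inv g | g s. g \<in> carrier G \<and> s \<in> S}"

definition bruhat_step :: "'w \<Rightarrow> 'w \<Rightarrow> bool" where
  "bruhat_step u w \<longleftrightarrow>
     u \<in> carrier G \<and> w \<in> carrier G \<and> len u < len w \<and> (\<exists>t \<in> refls. w = u \<otimes> t)"

definition bruhat_le :: "'w \<Rightarrow> 'w \<Rightarrow> bool" where
  "bruhat_le = rtranclp bruhat_step"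

definition bruhat_less :: "'w \<Rightarrow> 'w \<Rightarrow> bool" where
  "bruhat_less u w \<longleftrightarrow> bruhat_le u w \<and> u \<noteq> w"

definition sign :: "'w \<Rightarrow> 'g::linordered_ab_group_add gring" where
  "sign w = (-1) ^ len w"

definition suffix_le :: "'w \<Rightarrow> 'w \<Rightarrow> bool" where
  "suffix_le x y \<longleftrightarrow> (\<exists>z \<in> carrier G. y = z \<otimes> x \<and> len y = len z + len x)"

definition left_ideal :: "'w set \<Rightarrow> bool" where
  "left_ideal E \<longleftrightarrow> E \<subseteq> carrier G \<and> (\<forall>y \<in> E. \<forall>x \<in> carrier G. suffix_le x y \<longrightarrow> x \<in> E)"

definition DJ :: "'w set \<Rightarrow> 'w set" where
  "DJ J = {w \<in> carrier G. \<forall>s \<in> J. len w < len (w \<otimes> s)}"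

definition SD :: "'w \<Rightarrow> 'w set" where
  "SD y = {s \<in> S. len (s \<otimes> y) < len y}"

definition SA :: "'w set \<Rightarrow> 'w \<Rightarrow> 'w set" where
  "SA E y = {s \<in> S. len y < len (s \<otimes> y) \<and> s \<otimes> y \<in> E}"

definition WD :: "'w set \<Rightarrow> 'w \<Rightarrow> 'w set" where
  "WD J y = {s \<in> S. len y < len (s \<otimes> y) \<and> s \<otimes> y \<notin> DJ J}"

definition WA :: "'w set \<Rightarrow> 'w set \<Rightarrow> 'w \<Rightarrow> 'w set" where
  "WA E J y = {s \<in> S. len y < len (s \<otimes> y) \<and> s \<otimes> y \<in> DJ J - E}"

text \<open>
  The (multi)chain \<open>x\<^sub>0, \<dots>, x\<^bsub>k+1\<^esub>\<close> is represented by the list of its \<open>k + 2\<close> entries, so a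
  chain with \<open>k = 0\<close> is the list \<open>[x, y]\<close>.
\<close>

definition chains_of :: "('w \<Rightarrow> 'w \<Rightarrow> bool) \<Rightarrow> 'w set \<Rightarrow> nat \<Rightarrow> 'w \<Rightarrow> 'w \<Rightarrow> 'w list set" where
  "chains_of r E k x y =
     {xs. length xs = k + 2 \<and> set xs \<subseteq> E \<and> hd xs = x \<and> last xs = y \<and> successively r xs}"

definition chains :: "'w set \<Rightarrow> 'w \<Rightarrow> 'w \<Rightarrow> 'w list set" where
  "chains E x y = (\<Union>k. chains_of bruhat_less E k x y)"

definition multichains :: "'w set \<Rightarrow> 'w \<Rightarrow> 'w \<Rightarrow> 'w list set" where
  "multichains E x y = (\<Union>k. chains_of bruhat_le E k x y)"

end

locale weighted_coxeter_system = coxeter_system G S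
  for G :: "('w, 'x) monoid_scheme" (structure) and S +
  fixes L :: "'w \<Rightarrow> 'g::linordered_ab_group_add"
  assumes weight_reduced: "reduced_word ws w \<Longrightarrow> L w = sum_list (map L ws)"
    and weight_nonneg: "s \<in> S \<Longrightarrow> 0 \<le> L s"


section \<open>The Hecke algebra and modules afforded by \<open>W\<close>-graph ideals\<close>

text \<open>
  The Hecke algebra is any unital algebra \<open>'h\<close> over the group ring with a basis indexed by
  \<open>W\<close> and the stated multiplication rules, together with its bar involution; these data are
  determined up to isomorphism.
\<close>

locale hecke_algebra = weighted_coxeter_system G S L + hecke: Modules.module hscale
  for G :: "('w, 'x) monoid_scheme" (structure) and S
    and L :: "'w \<Rightarrow> 'g::linordered_ab_group_add"
    and hscale :: "'g gring \<Rightarrow> 'h::ring_1 \<Rightarrow> 'h" +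
  fixes T :: "'w \<Rightarrow> 'h" and hbar :: "'h \<Rightarrow> 'h"
  assumes hscale_left: "hscale c (a * b) = hscale c a * b"
    and hscale_right: "hscale c (a * b) = a * hscale c b"
    and T_inj: "inj_on T (carrier G)"
    and T_independent: "hecke.independent (T ` carrier G)"
    and T_span: "hecke.span (T ` carrier G) = UNIV"
    and T_one: "T \<one> = 1"
    and T_up: "\<lbrakk>s \<in> S; w \<in> carrier G; len w < len (s \<otimes> w)\<rbrakk> \<Longrightarrow> T s * T w = T (s \<otimes> w)"
    and T_down: "\<lbrakk>s \<in> S; w \<in> carrier G; len (s \<otimes> w) < len w\<rbrakk> \<Longrightarrow>
      T s * T w = hscale (qpow (L s)) (T (s \<otimes> w)) + hscale (qpow (L s) - 1) (T w)"
    and hbar_add: "hbar (a + b) = hbar a + hbar b"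
    and hbar_mult: "hbar (a * b) = hbar a * hbar b"
    and hbar_one: "hbar 1 = 1"
    and hbar_scale: "hbar (hscale c a) = hscale (gbar c) (hbar a)"
    and hbar_invol: "hbar (hbar a) = a"
    and hbar_T: "s \<in> S \<Longrightarrow>
      hbar (T s) = hscale (qpow (- L s)) (T s) + hscale (qpow (- L s) - 1) 1"

text \<open>
  \<open>E\<close> with the set \<open>J\<close> is a \<open>W\<close>-graph ideal precisely if data \<open>mscale\<close>, \<open>act\<close>, \<open>Gam\<close>, \<open>mbar\<close> as
  below exist; the locale fixes such a module.
\<close>

locale W_graph_ideal = hecke_algebra G S L hscale T hbar + wmod: Modules.module mscale
  for G :: "('w, 'x) monoid_scheme" (structure) and S
    and L :: "'w \<Rightarrow> 'g::linordered_ab_group_add"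
    and hscale :: "'g gring \<Rightarrow> 'h::ring_1 \<Rightarrow> 'h" and T hbar
    and mscale :: "'g gring \<Rightarrow> 'm::ab_group_add \<Rightarrow> 'm" +
  fixes E J :: "'w set"
    and act :: "'h \<Rightarrow> 'm \<Rightarrow> 'm" and Gam :: "'w \<Rightarrow> 'm" and mbar :: "'m \<Rightarrow> 'm"
  assumes E_ideal: "left_ideal E"
    and J_subset: "J \<subseteq> {s \<in> S. \<forall>x \<in> E. len x < len (x \<otimes> s)}"
    and act_add_left: "act (a + b) m = act a m + act b m"
    and act_add_right: "act a (m + n) = act a m + act a n"
    and act_mult: "act (a * b) m = act a (act b m)"
    and act_one: "act 1 m = m"
    and act_scale: "act (hscale c a) m = mscale c (act a m)"
    and Gam_inj: "inj_on Gam E"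
    and Gam_independent: "wmod.independent (Gam ` E)"
    and Gam_span: "wmod.span (Gam ` E) = UNIV"
    and act_SD: "\<lbrakk>y \<in> E; s \<in> SD y\<rbrakk> \<Longrightarrow>
      act (T s) (Gam y) = mscale (qpow (L s)) (Gam (s \<otimes> y)) + mscale (qpow (L s) - 1) (Gam y)"
    and act_SA: "\<lbrakk>y \<in> E; s \<in> SA E y\<rbrakk> \<Longrightarrow> act (T s) (Gam y) = Gam (s \<otimes> y)"
    and act_WD: "\<lbrakk>y \<in> E; s \<in> WD J y\<rbrakk> \<Longrightarrow> act (T s) (Gam y) = - Gam y"
    and act_WA: "\<lbrakk>y \<in> E; s \<in> WA E J y\<rbrakk> \<Longrightarrow>
      \<exists>r. (\<forall>z. r z \<in> range (\<lambda>c. qpow (L s) * c)) \<and>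
        act (T s) (Gam y) = mscale (qpow (L s)) (Gam y) -
          (\<Sum>z | z \<in> E \<and> bruhat_less z (s \<otimes> y). mscale (r z) (Gam z))"
    and mbar_add: "mbar (m + n) = mbar m + mbar n"
    and mbar_scale: "mbar (mscale c m) = mscale (gbar c) (mbar m)"
    and mbar_invol: "mbar (mbar m) = m"
    and mbar_Gam_one: "mbar (Gam \<one>) = Gam \<one>"
    and mbar_act: "\<lbrakk>w \<in> carrier G; y \<in> E\<rbrakk> \<Longrightarrow>
      mbar (act (T w) (Gam y)) = act (hbar (T w)) (mbar (Gam y))"
begin

text \<open>
  The \<open>R\<close>-polynomials are obtained by solving their defining relation (\<open>mbar_Gam_Rpoly\<close> below)
  for the coefficients of \<open>mbar (Gam y)\<close> with respect to the basis \<open>Gam ` E\<close>.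
\<close>

definition Rpoly :: "'w \<Rightarrow> 'w \<Rightarrow> 'g gring" where
  "Rpoly x y = sign x * sign y * qpow (L y) * wmod.representation (Gam ` E) (mbar (Gam y)) (Gam x)"

definition scrR_two :: "'w \<Rightarrow> 'w \<Rightarrow> 'g gring" where
  "scrR_two x y = qpow (- L x) * qpow (L y) * gbar (Rpoly x y)"

text \<open>The values on lists with fewer than two entries are irrelevant.\<close>

fun scrR :: "'w list \<Rightarrow> 'g gring" where
  "scrR [x, y] = scrR_two x y"
| "scrR (x # x1 # x2 # xs) =
     scrR_two x x1 *
     upper_half (L (last (x2 # xs)) - L x1)
       (qpow (- L x1) * qpow (L (last (x2 # xs))) * gbar (scrR (x1 # x2 # xs)))"
| "scrR [] = 0"
| "scrR [x] = 0"

text \<open>The degree bound \<open>deg P < (L y - L x)/2\<close> is expressed as \<open>deg P + deg P < L y - L x\<close>.\<close>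

definition KL_family :: "('w \<Rightarrow> 'w \<Rightarrow> 'g gring) \<Rightarrow> bool" where
  "KL_family P \<longleftrightarrow>
     (\<forall>x \<in> E. \<forall>y \<in> E. \<not> bruhat_le x y \<longrightarrow> P x y = 0) \<and>
     (\<forall>x \<in> E. P x x = 1) \<and>
     (\<forall>x \<in> E. \<forall>y \<in> E. bruhat_less x y \<longrightarrow>
        gdeg (P x y) + gdeg (P x y) < Fin (L y - L x)) \<and>
     (\<forall>x \<in> E. \<forall>y \<in> E. qpow (- L x) * qpow (L y) * gbar (P x y) =
        (\<Sum>t | t \<in> E \<and> bruhat_le x t \<and> bruhat_le t y. Rpoly x t * P t y))"

lemma sign_square: "sign x * sign x = (1 :: 'g gring)"
  by (simp add: sign_def flip: power_add)

lemma qpow_minus: "qpow (- \<gamma>) * qpow \<gamma> = (1 :: 'g gring)"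
  by (simp add: qpow_def mult_single)

lemma mbar_Gam_Rpoly:
  assumes "y \<in> E"
  shows "finite {x \<in> E. Rpoly x y \<noteq> 0}"
    and "mbar (Gam y) =
      (\<Sum>x | x \<in> E \<and> Rpoly x y \<noteq> 0.
         mscale (sign x * sign y * qpow (- L y) * Rpoly x y) (Gam x))"
proof -
  let ?c = "wmod.representation (Gam ` E) (mbar (Gam y))"
  have c: "sign x * sign y * qpow (- L y) * Rpoly x y = ?c (Gam x)" for x
  proof -
    have "sign x * sign y * qpow (- L y) * Rpoly x y =
      (sign x * sign x) * (sign y * sign y) * (qpow (- L y) * qpow (L y)) * ?c (Gam x)"
      by (simp only: Rpoly_def ac_simps)
    then show ?thesis
      by (simp add: sign_square qpow_minus)
  qed
  have nz: "Rpoly x y \<noteq> 0 \<longleftrightarrow> ?c (Gam x) \<noteq> 0" for x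
  proof
    show "?c (Gam x) \<noteq> 0" if "Rpoly x y \<noteq> 0"
      using that by (auto simp: Rpoly_def)
    show "Rpoly x y \<noteq> 0" if "?c (Gam x) \<noteq> 0"
      using that c[of x] by auto
  qed
  have img: "{b. ?c b \<noteq> 0} = Gam ` {x \<in> E. Rpoly x y \<noteq> 0}"
    using wmod.representation_ne_zero[of "Gam ` E" "mbar (Gam y)"] by (auto simp: nz)
  have inj: "inj_on Gam {x \<in> E. Rpoly x y \<noteq> 0}"
    using Gam_inj by (rule inj_on_subset) auto
  show "finite {x \<in> E. Rpoly x y \<noteq> 0}"
    using wmod.finite_representation[of "Gam ` E" "mbar (Gam y)"] inj
    by (simp add: img finite_image_iff)
  have "mbar (Gam y) = (\<Sum>b | ?c b \<noteq> 0. mscale (?c b) b)"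
    using Gam_independent Gam_span by (simp add: wmod.sum_nonzero_representation_eq)
  also have "\<dots> = (\<Sum>x | x \<in> E \<and> Rpoly x y \<noteq> 0. mscale (?c (Gam x)) (Gam x))"
    unfolding img by (subst sum.reindex[OF inj]) simp
  finally show "mbar (Gam y) = (\<Sum>x | x \<in> E \<and> Rpoly x y \<noteq> 0.
      mscale (sign x * sign y * qpow (- L y) * Rpoly x y) (Gam x))"
    by (simp add: c)
qed

end

end

theory Submission
  imports Defs
begin

text \<open>
  Applying the bar involution to the defining relation of the Kazhdan-Lusztig polynomials gives
  \<open>P x y - q\<^bsup>L y - L x\<^esup> bar (P x y) = \<R> x y + \<Sum>\<^bsub>x < t < y\<^esub> \<R> x t q\<^bsup>L y - L t\<^esup> bar (P t y)\<close>, where the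
  degree bound places \<open>P t y\<close> strictly below and \<open>q\<^bsup>L y - L t\<^esup> bar (P t y)\<close> strictly above
  \<open>(L y - L t)/2\<close>. Iterating this recursion expresses its left-hand side as the sum over strict
  chains, from which truncation recovers \<open>P x y\<close>; allowing the first step of a multichain to be
  trivial restores the missing summand \<open>q\<^bsup>L y - L x\<^esup> bar (P x y)\<close>. The diagonal case of the defining
  relation forces \<open>R x x = 1\<close>, so the only input from Coxeter groups is that lower Bruhat intervals
  are finite. This follows from the strong exchange property, obtained by counting modulo 2 how
  often a reflection occurs along a word.
\<close>

section \<open>Finiteness of lower Bruhat intervals\<close>

context coxeter_system
begin

section \<open>Words in the generators and the length function\<close>

lemma word_prod_Nil [simp]: "word_prod G [] = \<one>"
  and word_prod_Cons [simp]: "word_prod G (s # ws) = s \<otimes> word_prod G ws"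
  by (simp_all add: word_prod_def)

lemma S_in_carrier [simp]: "s \<in> S \<Longrightarrow> s \<in> carrier G"
  using S_closed by blast

lemma inv_S [simp]: "s \<in> S \<Longrightarrow> inv s = s"
  by (simp add: S_involution inv_equality)

lemma cancel_inv_left:
  assumes "g \<in> carrier G" "x \<in> carrier G"
  shows "inv g \<otimes> (g \<otimes> x) = x" "g \<otimes> (inv g \<otimes> x) = x"
  using assms by (simp_all flip: m_assoc)

lemma S_cancel: "s \<in> S \<Longrightarrow> x \<in> carrier G \<Longrightarrow> s \<otimes> (s \<otimes> x) = x"
  using cancel_inv_left(1)[of s x] by simp

lemma word_prod_closed [simp]: "ws \<in> lists S \<Longrightarrow> word_prod G ws \<in> carrier G"
  by (induction ws) auto

lemma word_prod_append:
  "us \<in> lists S \<Longrightarrow> vs \<in> lists S \<Longrightarrow> word_prod G (us @ vs) = word_prod G us \<otimes> word_prod G vs"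
  by (induction us) (auto simp: m_assoc)

lemma word_prod_rev: "ws \<in> lists S \<Longrightarrow> word_prod G (rev ws) = inv (word_prod G ws)"
  by (induction ws) (auto simp: word_prod_append inv_mult_group in_lists_conv_set)

lemma word_exists:
  assumes "w \<in> carrier G"
  obtains ws where "ws \<in> lists S" "word_prod G ws = w"
proof -
  have "w \<in> generate G S"
    using assms by (simp add: S_generates)
  then have "\<exists>ws \<in> lists S. word_prod G ws = w"
  proof induction
    case one
    show ?case by (rule bexI[of _ "[]"]) auto
  next
    case (incl h)
    then show ?case by (intro bexI[of _ "[h]"]) auto
  next
    case (inv h)
    then show ?case by (intro bexI[of _ "[h]"]) auto
  next
    case (eng h1 h2)
    then obtain us vs where "us \<in> lists S" "word_prod G us = h1" "vs \<in> lists S" "word_prod G vs = h2"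
      by blast
    then show ?case by (intro bexI[of _ "us @ vs"]) (auto simp: word_prod_append)
  qed
  then show ?thesis using that by blast
qed

lemma len_le: "ws \<in> lists S \<Longrightarrow> len (word_prod G ws) \<le> length ws"
  unfolding len_def by (rule Least_le) blast

lemma reduced_word_exists:
  assumes "w \<in> carrier G"
  obtains ws where "ws \<in> lists S" "word_prod G ws = w" "length ws = len w"
proof -
  obtain us where "us \<in> lists S" "word_prod G us = w"
    using assms by (rule word_exists)
  then have "\<exists>k. \<exists>ws \<in> lists S. word_prod G ws = w \<and> length ws = k"
    by blast
  from LeastI_ex[OF this] show ?thesis
    using that unfolding len_def by blast
qed

section \<open>Parity of the reflections occurring along a word\<close>

fun refl_list :: "'w list \<Rightarrow> 'w list" where
  "refl_list [] = []"
| "refl_list (s # ws) = (inv (word_prod G ws) \<otimes> s \<otimes> word_prod G ws) # refl_list ws"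

text \<open>For a word \<open>s_1 ... s_k\<close> the entries counted are
  \<open>t_i = (s_(i+1) ... s_k)^(-1) s_i (s_(i+1) ... s_k)\<close>, the reflections whose right
  multiplication deletes the letter \<open>s_i\<close>. Their list depends on the word; the parities
  will turn out to depend only on its product.\<close>

definition odd_refl :: "'w list \<Rightarrow> 'w \<Rightarrow> bool" where
  "odd_refl ws t \<longleftrightarrow> odd (count_list (refl_list ws) t)"

lemma refl_list_closed: "ws \<in> lists S \<Longrightarrow> set (refl_list ws) \<subseteq> carrier G"
  by (induction ws) auto

lemma refl_list_append:
  assumes "us \<in> lists S" "vs \<in> lists S"
  shows "refl_list (us @ vs) =
    map (\<lambda>x. inv (word_prod G vs) \<otimes> x \<otimes> word_prod G vs) (refl_list us) @ refl_list vs"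
  using assms(1)
proof (induction us)
  case (Cons s us)
  then show ?case
    using assms(2) by (auto simp: word_prod_append inv_mult_group m_assoc)
qed simp

lemma count_list_map_conj:
  assumes "set xs \<subseteq> carrier G" "g \<in> carrier G" "x \<in> carrier G"
  shows "count_list (map (\<lambda>y. inv g \<otimes> y \<otimes> g) xs) x = count_list xs (g \<otimes> x \<otimes> inv g)"
  using assms(1)
proof (induction xs)
  case (Cons y xs)
  have "inv g \<otimes> y \<otimes> g = x \<longleftrightarrow> y = g \<otimes> x \<otimes> inv g"
  proof
    show "y = g \<otimes> x \<otimes> inv g" if "inv g \<otimes> y \<otimes> g = x"
      using that[symmetric] Cons.prems assms(2) by (simp add: m_assoc cancel_inv_left)
    show "inv g \<otimes> y \<otimes> g = x" if "y = g \<otimes> x \<otimes> inv g"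
      using that Cons.prems assms(2,3) by (simp add: m_assoc cancel_inv_left)
  qed
  then show ?case
    using Cons by simp
qed simp

text \<open>A cocycle rule: appending \<open>vs\<close> conjugates the reflections of
  \<open>us\<close> by the product of \<open>vs\<close>, and parities add, which for truth values is
  \<open>\<noteq>\<close>.\<close>

lemma odd_refl_append:
  assumes "us \<in> lists S" "vs \<in> lists S" "x \<in> carrier G"
  shows "odd_refl (us @ vs) x \<longleftrightarrow>
    odd_refl us (word_prod G vs \<otimes> x \<otimes> inv (word_prod G vs)) \<noteq> odd_refl vs x"
  using assms
  by (simp add: odd_refl_def refl_list_append count_list_map_conj refl_list_closed)

lemma word_prod_relator:
  assumes "s \<in> S" "t \<in> S"
  shows "concat (replicate j [s, t]) \<in> lists S"
    and "word_prod G (concat (replicate j [s, t])) = (s \<otimes> t) [^] j"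
proof (induction j)
  case (Suc j)
  {
    case 1
    then show ?case using Suc assms by simp
  next
    case 2
    have "(s \<otimes> t) [^] Suc j = (s \<otimes> t) \<otimes> (s \<otimes> t) [^] j"
      using assms by (intro nat_pow_Suc2) simp
    then show ?case using Suc assms by (simp add: m_assoc)
  }
qed simp_all

text \<open>The dihedral relation: conjugation by \<open>t\<close> inverts
  \<open>s \<otimes> t\<close>.\<close>

lemma pow_conj_S:
  assumes "s \<in> S" "t \<in> S"
  shows "(s \<otimes> t) [^] (j::nat) \<otimes> t \<otimes> (s \<otimes> t) [^] j = t"
proof (induction j)
  case (Suc j)
  let ?a = "s \<otimes> t"
  have [simp]: "s \<in> carrier G" "t \<in> carrier G" using assms by auto
  have a: "?a \<otimes> t \<otimes> ?a = t"
    using assms by (simp add: m_assoc S_cancel)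
  \<comment> \<open>The left power gives up its last factor and the right power its first, so both
    meet around \<open>t\<close>.\<close>
  have "?a [^] Suc j \<otimes> t \<otimes> ?a [^] Suc j = ?a [^] j \<otimes> (?a \<otimes> t \<otimes> ?a) \<otimes> ?a [^] j"
    by (subst (2) nat_pow_Suc2, simp, subst nat_pow_Suc) (simp add: m_assoc)
  then show ?case using Suc a by simp
qed (use assms in simp)

text \<open>Each further pair \<open>[s, t]\<close> is put in front and contributes the next two
  exponents, \<open>2 * j + 1\<close> from \<open>s\<close> and \<open>2 * j\<close> from
  \<open>t\<close>; hence the decreasing order.\<close>

lemma refl_list_relator:
  assumes "s \<in> S" "t \<in> S"
  shows "refl_list (concat (replicate j [s, t])) = rev (map (\<lambda>i. t \<otimes> (s \<otimes> t) [^] i) [0..<2 * j])"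
proof (induction j)
  case (Suc j)
  let ?a = "s \<otimes> t"
  have [simp]: "s \<in> carrier G" "t \<in> carrier G" using assms by auto
  have conj: "inv (?a [^] j) \<otimes> t = t \<otimes> ?a [^] j"
    using inv_solve_left'[of "t \<otimes> ?a [^] j" "?a [^] j" t] pow_conj_S[OF assms, of j]
    by (simp add: m_assoc)
  have 1: "inv (?a [^] j) \<otimes> t \<otimes> ?a [^] j = t \<otimes> ?a [^] (2 * j)"
    unfolding conj mult_2 by (simp add: m_assoc nat_pow_mult)
  have "inv (t \<otimes> ?a [^] j) \<otimes> s \<otimes> (t \<otimes> ?a [^] j) = inv (?a [^] j) \<otimes> t \<otimes> (?a \<otimes> ?a [^] j)"
    using assms by (simp add: inv_mult_group m_assoc)
  also have "?a \<otimes> ?a [^] j = ?a [^] Suc j"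
    by (rule nat_pow_Suc2[symmetric]) simp
  also have "inv (?a [^] j) \<otimes> t \<otimes> ?a [^] Suc j = t \<otimes> (?a [^] j \<otimes> ?a [^] Suc j)"
    unfolding conj by (intro m_assoc) simp_all
  also have "?a [^] j \<otimes> ?a [^] Suc j = ?a [^] Suc (2 * j)"
    using nat_pow_mult[of ?a j "Suc j"] by (simp only: mult_2 add_Suc_right) simp
  finally show ?case
    using Suc 1 assms by (simp add: word_prod_relator)
qed simp

text \<open>The exponents \<open>0, ..., 2m - 1\<close> run twice through all residues modulo the
  order \<open>m\<close>, so every reflection is counted an even number of times. For infinite order
  \<open>m = 0\<close> and the word is empty.\<close>

lemma odd_refl_relator:
  assumes "s \<in> S" "t \<in> S"
  shows "\<not> odd_refl (concat (replicate (ord (s \<otimes> t)) [s, t])) x"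
proof -
  let ?a = "s \<otimes> t" let ?m = "ord ?a"
  have a: "?a \<in> carrier G" using assms by simp
  have "[0..<2 * ?m] = [0..<?m] @ map (\<lambda>i. i + ?m) [0..<?m]"
    using upt_add_eq_append[of 0 ?m ?m] by (simp add: map_add_upt mult_2)
  moreover have "?a [^] (i + ?m) = ?a [^] i" for i
    using nat_pow_mult[OF a, of i ?m] a by (simp add: pow_ord_eq_1)
  ultimately have "map (\<lambda>i. t \<otimes> ?a [^] i) [0..<2 * ?m] =
      map (\<lambda>i. t \<otimes> ?a [^] i) [0..<?m] @ map (\<lambda>i. t \<otimes> ?a [^] i) [0..<?m]"
    by (simp only: map_append map_map comp_def)
  then show ?thesis
    by (simp add: odd_refl_def refl_list_relator[OF assms])
qed

text \<open>The deleted relator has even counts and product \<open>\<one>\<close>, so it neither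
  adds to the parity nor changes the conjugation applied to the letters before it.\<close>

lemma odd_refl_move:
  assumes "coxeter_move G S us vs" "x \<in> carrier G"
  shows "odd_refl us x \<longleftrightarrow> odd_refl vs x"
proof -
  obtain a b s t where ab: "a \<in> lists S" "b \<in> lists S" and st: "s \<in> S" "t \<in> S"
    and u: "us = a @ concat (replicate (ord (s \<otimes> t)) [s, t]) @ b" and v: "vs = a @ b"
    using assms(1) unfolding coxeter_move_def by blast
  let ?r = "concat (replicate (ord (s \<otimes> t)) [s, t])"
  have r: "?r \<in> lists S" "word_prod G ?r = \<one>"
    using st by (simp_all add: word_prod_relator pow_ord_eq_1)
  then have rb: "?r @ b \<in> lists S" "word_prod G (?r @ b) = word_prod G b"
    using ab by (simp_all add: word_prod_append)
  show ?thesis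
    unfolding u v using ab r rb assms(2) odd_refl_relator[OF st]
    by (simp only: odd_refl_append) simp
qed

lemma odd_refl_cong:
  assumes "us \<in> lists S" "vs \<in> lists S" "word_prod G us = word_prod G vs" "x \<in> carrier G"
  shows "odd_refl us x \<longleftrightarrow> odd_refl vs x"
  using presentation[OF assms(1-3)]
proof (induction rule: equivclp_induct)
  case (step y z)
  then show ?case using odd_refl_move assms(4) by blast
qed simp

section \<open>Reflections, strong exchange and finiteness\<close>

lemma refls_closed: "t \<in> refls \<Longrightarrow> t \<in> carrier G"
  unfolding refls_def by auto

lemma refls_involution:
  assumes "t \<in> refls"
  shows "t \<otimes> t = \<one>"
proof -
  obtain g s where "g \<in> carrier G" and s: "s \<in> S" and t: "t = g \<otimes> s \<otimes> inv g"
    using assms unfolding refls_def by blast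
  then have "t \<otimes> t = g \<otimes> (s \<otimes> s) \<otimes> inv g"
    by (simp add: m_assoc cancel_inv_left)
  then show ?thesis using \<open>g \<in> carrier G\<close> s by (simp add: S_involution)
qed

text \<open>The palindrome \<open>us @ [s] @ rev us\<close> works: the contributions of its two
  outer parts have equal parity and cancel, and its middle letter contributes \<open>t\<close>
  once.\<close>

lemma refl_word:
  assumes "t \<in> refls"
  obtains ws where "ws \<in> lists S" "word_prod G ws = t" "odd_refl ws t"
proof -
  obtain g s where g: "g \<in> carrier G" and s: "s \<in> S" and t: "t = g \<otimes> s \<otimes> inv g"
    using assms unfolding refls_def by blast
  obtain us where us: "us \<in> lists S" "word_prod G us = g"
    using word_exists[OF g] by blast
  have rus: "rev us \<in> lists S" using us(1) by (simp add: in_lists_conv_set)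
  have tc: "t \<in> carrier G" using g s t by simp
  \<comment> \<open>Without the middle letter the palindrome spells \<open>\<one>\<close>, so it has
    the parity of the empty word.\<close>
  have "\<not> odd_refl (us @ rev us) t"
  proof -
    have "word_prod G (us @ rev us) = word_prod G []"
      using us rus g by (simp add: word_prod_append word_prod_rev)
    then have "odd_refl (us @ rev us) t \<longleftrightarrow> odd_refl [] t"
      using us rus tc by (intro odd_refl_cong) auto
    then show ?thesis by (simp add: odd_refl_def)
  qed
  moreover have conj: "inv g \<otimes> t \<otimes> g = s"
    using g s t by (simp add: m_assoc cancel_inv_left)
  ultimately have eq: "odd_refl us s \<longleftrightarrow> odd_refl (rev us) t"
    using us rus tc g by (simp add: odd_refl_append word_prod_rev)
  let ?vs = "[s] @ rev us"
  have vs: "?vs \<in> lists S" "word_prod G ?vs = s \<otimes> inv g"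
    using us rus s by (auto simp: word_prod_rev)
  \<comment> \<open>Carrying \<open>t\<close> past \<open>[s] @ rev us\<close> yields
    \<open>s\<close>, just as carrying it past \<open>rev us\<close> alone; so \<open>us\<close>
    contributes the same parity in both palindromes.\<close>
  have "s \<otimes> inv g \<otimes> t \<otimes> inv (s \<otimes> inv g) = s \<otimes> (inv g \<otimes> t \<otimes> g) \<otimes> s"
    using g s tc by (simp add: inv_mult_group m_assoc)
  also have "\<dots> = s"
    using s conj by (simp add: S_involution)
  finally have "odd_refl (us @ ?vs) t \<longleftrightarrow> odd_refl us s \<noteq> odd_refl ?vs t"
    using odd_refl_append[OF us(1) vs(1) tc] vs(2) by simp
  moreover have "odd_refl ?vs t \<longleftrightarrow> odd_refl [s] s \<noteq> odd_refl (rev us) t"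
    using odd_refl_append[of "[s]" "rev us" t] us rus s tc g conj by (simp add: word_prod_rev)
  moreover have "odd_refl [s] s"
    using s by (simp add: odd_refl_def)
  ultimately have "odd_refl (us @ [s] @ rev us) t"
    using eq by blast
  moreover have "word_prod G (us @ [s] @ rev us) = t"
    using us rus s g t by (simp add: word_prod_append word_prod_rev m_assoc)
  ultimately show ?thesis
    using that[of "us @ [s] @ rev us"] us rus s by simp
qed

text \<open>The witness is \<open>ws\<close> with one letter deleted, namely the letter that
  produced the entry \<open>t\<close>.\<close>

lemma refl_list_exchange:
  assumes "ws \<in> lists S" "t \<in> set (refl_list ws)"
  shows "\<exists>vs \<in> lists S. length vs < length ws \<and> word_prod G vs = word_prod G ws \<otimes> t"
  using assms
proof (induction ws rule: list.induct)
  case (Cons s ws)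
  from Cons.prems(2) consider
      "t = inv (word_prod G ws) \<otimes> s \<otimes> word_prod G ws" | "t \<in> set (refl_list ws)"
    by auto
  then show ?case
  proof cases
    case 1
    have "s \<in> S" "ws \<in> lists S" using Cons.prems by auto
    moreover from this have "word_prod G (s # ws) \<otimes> t = (s \<otimes> s) \<otimes> word_prod G ws"
      by (simp add: 1 m_assoc cancel_inv_left)
    ultimately show ?thesis
      by (intro bexI[of _ ws]) (auto simp: S_involution)
  next
    case 2
    then obtain vs where "vs \<in> lists S" "length vs < length ws"
        "word_prod G vs = word_prod G ws \<otimes> t"
      using Cons by auto
    moreover have "t \<in> carrier G" using 2 Cons.prems refl_list_closed[of ws] by auto
    ultimately show ?thesis
      using Cons.prems by (intro bexI[of _ "s # vs"]) (auto simp: m_assoc)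
  qed
qed simp

text \<open>
  A reflection \<open>t\<close> that does not occur an odd number of times in a word for \<open>w\<close> occurs in every
  reduced word for \<open>w t\<close>, and deleting the corresponding letter there makes \<open>w\<close> shorter than \<open>w t\<close>.
\<close>

lemma shortening_refl_in_refl_list:
  assumes "t \<in> refls" "ws \<in> lists S" "len (word_prod G ws \<otimes> t) < len (word_prod G ws)"
  shows "t \<in> set (refl_list ws)"
proof (rule ccontr)
  assume "t \<notin> set (refl_list ws)"
  then have no: "\<not> odd_refl ws t" by (simp add: odd_refl_def)
  obtain ts where ts: "ts \<in> lists S" "word_prod G ts = t" "odd_refl ts t"
    using refl_word[OF assms(1)] .
  have t: "t \<in> carrier G" and tt: "t \<otimes> t = \<one>"
    using assms(1) by (simp_all add: refls_closed refls_involution)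
  obtain vs where vs: "vs \<in> lists S" "word_prod G vs = word_prod G ws \<otimes> t"
      "length vs = len (word_prod G ws \<otimes> t)"
    using reduced_word_exists[of "word_prod G ws \<otimes> t"] assms(2) t by auto
  have "odd_refl vs t \<longleftrightarrow> odd_refl (ws @ ts) t"
    using vs ts assms(2) t by (intro odd_refl_cong) (auto simp: word_prod_append)
  \<comment> \<open>By the cocycle rule \<open>t\<close> is carried past \<open>ts\<close>
    unchanged, because \<open>ts\<close> spells \<open>t\<close> itself; \<open>ws\<close> then
    contributes an even count and \<open>ts\<close> an odd one.\<close>
  also have "\<dots>"
    using ts no assms(2) t by (simp add: odd_refl_append m_assoc)
  finally have "t \<in> set (refl_list vs)"
    unfolding odd_refl_def using count_notin by fastforce
  then obtain us where "us \<in> lists S" "length us < length vs"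
      "word_prod G us = word_prod G vs \<otimes> t"
    using refl_list_exchange vs(1) by blast
  moreover from this have "word_prod G us = word_prod G ws"
    using vs assms(2) t tt by (simp add: m_assoc)
  ultimately show False
    using len_le[of us] vs assms(3) by simp
qed

text \<open>Each such \<open>u\<close> is \<open>w \<otimes> t\<close> for a reflection
  \<open>t\<close> that shortens \<open>w\<close>, and by strong exchange \<open>t\<close> lies in
  the finite list of any one word for \<open>w\<close>.\<close>

lemma finite_bruhat_step: "finite {u. bruhat_step u w}"
proof (cases "w \<in> carrier G")
  case True
  then obtain ws where ws: "ws \<in> lists S" "word_prod G ws = w"
    using word_exists by blast
  have "{u. bruhat_step u w} \<subseteq> (\<lambda>t. w \<otimes> t) ` set (refl_list ws)"
  proof
    fix u assume "u \<in> {u. bruhat_step u w}"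
    then obtain t where u: "u \<in> carrier G" "len u < len w" "t \<in> refls" "w = u \<otimes> t"
      unfolding bruhat_step_def by blast
    have t: "t \<in> carrier G" "t \<otimes> t = \<one>"
      using u(3) by (simp_all add: refls_closed refls_involution)
    have wt: "w \<otimes> t = u" using u t by (simp add: m_assoc)
    have "t \<in> set (refl_list ws)"
      using u(2,3) by (intro shortening_refl_in_refl_list ws(1)) (simp_all add: ws(2) wt)
    then show "u \<in> (\<lambda>t. w \<otimes> t) ` set (refl_list ws)" using wt by blast
  qed
  then show ?thesis by (rule finite_subset) simp
qed (simp add: bruhat_step_def)

lemma finite_bruhat_le: "finite {u. bruhat_le u w}"
proof (induction "len w" arbitrary: w rule: less_induct)
  case less
  have "{u. bruhat_le u w} \<subseteq> insert w (\<Union>v \<in> {v. bruhat_step v w}. {u. bruhat_le u v})"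
    unfolding bruhat_le_def by (auto elim: rtranclp.cases)
  moreover have "finite {u. bruhat_le u v}" if "bruhat_step v w" for v
    using less that by (simp add: bruhat_step_def)
  ultimately show ?case
    using finite_bruhat_step by (elim finite_subset) auto
qed

lemma bruhat_le_refl [simp]: "bruhat_le x x"
  by (simp add: bruhat_le_def)

lemma bruhat_le_trans: "bruhat_le x y \<Longrightarrow> bruhat_le y z \<Longrightarrow> bruhat_le x z"
  by (simp add: bruhat_le_def)

lemma bruhat_less_len: "bruhat_less x y \<Longrightarrow> len x < len y"
proof -
  have "x = y \<or> len x < len y" if "bruhat_le x y"
    using that unfolding bruhat_le_def
    by (induction rule: rtranclp_induct) (auto simp: bruhat_step_def)
  then show "bruhat_less x y \<Longrightarrow> len x < len y"
    by (auto simp: bruhat_less_def)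
qed

lemma bruhat_le_antisym: "bruhat_le x y \<Longrightarrow> bruhat_le y x \<Longrightarrow> x = y"
  using bruhat_less_len[of x y] bruhat_less_len[of y x] unfolding bruhat_less_def by force

end

section \<open>The reflected bar involution of the group ring\<close>

text \<open>Sends \<open>q^\<gamma>\<close> to \<open>q^(\<zeta> - \<gamma>)\<close>, reflecting
  exponents in the truncation point \<open>\<zeta>/2\<close>. With
  \<open>\<zeta> = L y - L x\<close> it is the twisted bar of both the defining relation and the
  recursion for \<open>scrR\<close>.\<close>

definition gflip :: "'g::linordered_ab_group_add \<Rightarrow> 'g gring \<Rightarrow> 'g gring" where
  "gflip \<zeta> f = qpow \<zeta> * gbar f"

lemma inj_uminus_group: "inj (uminus :: 'g::ab_group_add \<Rightarrow> 'g)"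
  by (rule injI) simp

lemma gbar_zero: "gbar 0 = 0"
  by (simp add: gbar_def inj_uminus_group)

lemma gbar_add: "gbar (f + g) = gbar f + gbar g"
  by (simp add: gbar_def map_key_plus inj_uminus_group)

lemma gbar_single: "gbar (Poly_Mapping.single \<gamma> c) = Poly_Mapping.single (- \<gamma>) c"
  using map_key_single[OF inj_uminus_group, of "- \<gamma>" c] by (simp add: gbar_def)

lemma gring_induct [case_names zero add]:
  assumes "P 0" "\<And>\<gamma> c f. P f \<Longrightarrow> P (Poly_Mapping.single \<gamma> c + f)"
  shows "P (f :: 'g gring)"
proof (induction f rule: update_induct)
  case const
  then show ?case by (rule assms(1))
next
  case (update f a b)
  have "Poly_Mapping.update a b f = Poly_Mapping.single a b + f"
    using update(1) by (intro poly_mapping_eqI)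
      (auto simp: lookup_update lookup_add lookup_single when_def in_keys_iff)
  then show ?case using update assms(2) by simp
qed

lemma gbar_mult: "gbar (f * g) = gbar f * gbar (g :: 'g::linordered_ab_group_add gring)"
proof (induction f rule: gring_induct)
  case (add \<gamma> c f)
  have "gbar (Poly_Mapping.single \<gamma> c * g) = Poly_Mapping.single (- \<gamma>) c * gbar g"
    by (induction g rule: gring_induct)
      (simp_all add: gbar_zero gbar_add gbar_single distrib_left mult_single)
  then show ?case
    using add by (simp add: distrib_right gbar_add gbar_single)
qed (simp add: gbar_zero)

lemma qpow_add: "qpow (\<gamma> + \<zeta>) = qpow \<gamma> * qpow \<zeta>"
  by (simp add: qpow_def mult_single)

lemma gflip_zero [simp]: "gflip \<zeta> 0 = 0"
  by (simp add: gflip_def gbar_zero)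

lemma gflip_add: "gflip \<zeta> (f + g) = gflip \<zeta> f + gflip \<zeta> g"
  by (simp add: gflip_def gbar_add distrib_left)

lemma gflip_single: "gflip \<zeta> (Poly_Mapping.single \<gamma> c) = Poly_Mapping.single (\<zeta> - \<gamma>) c"
  by (simp add: gflip_def gbar_single qpow_def mult_single)

lemma gflip_one: "gflip 0 1 = 1"
  using gflip_single[of 0 0 1] by simp

lemma lookup_gflip: "Poly_Mapping.lookup (gflip \<zeta> f) \<gamma> = Poly_Mapping.lookup f (\<zeta> - \<gamma>)"
  by (induction f rule: gring_induct)
    (auto simp: gflip_add gflip_single lookup_add lookup_single when_def)

lemma gflip_gflip [simp]: "gflip \<zeta> (gflip \<zeta> f) = f"
  by (rule poly_mapping_eqI) (simp add: lookup_gflip)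

text \<open>Lets the defining relation be reflected termwise, splitting \<open>L y - L x\<close> as
  \<open>(L t - L x) + (L y - L t)\<close>.\<close>

lemma gflip_mult: "gflip (\<zeta> + \<xi>) (f * g) = gflip \<zeta> f * gflip \<xi> g"
  by (simp add: gflip_def gbar_mult qpow_add ac_simps)

lemma gflip_sum: "gflip \<zeta> (sum f A) = (\<Sum>a\<in>A. gflip \<zeta> (f a))"
  by (induction A rule: infinite_finite_induct) (simp_all add: gflip_add)

section \<open>Truncations and their interplay with the reflection\<close>

lemma upper_half_zero [simp]: "upper_half \<zeta> 0 = 0"
  by (rule poly_mapping_eqI) (simp add: upper_half.rep_eq)

lemma upper_half_add: "upper_half \<zeta> (f + g) = upper_half \<zeta> f + upper_half \<zeta> g"
  by (rule poly_mapping_eqI) (simp add: upper_half.rep_eq lookup_add)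

lemma upper_half_one: "upper_half 0 1 = 0"
  by (rule poly_mapping_eqI) (auto simp: upper_half.rep_eq lookup_one when_def)

lemma lower_half_diff: "lower_half \<zeta> (f - g) = lower_half \<zeta> f - lower_half \<zeta> g"
  by (rule poly_mapping_eqI) (simp add: lower_half.rep_eq lookup_minus)

lemma lower_half_upper_half: "lower_half \<zeta> (upper_half \<zeta> f) = 0"
  by (rule poly_mapping_eqI) (auto simp: lower_half.rep_eq upper_half.rep_eq)

text \<open>Reflection in \<open>\<zeta>/2\<close> exchanges the two open halves.\<close>

lemma upper_half_gflip: "upper_half \<zeta> (gflip \<zeta> f) = gflip \<zeta> (lower_half \<zeta> f)"
proof (rule poly_mapping_eqI)
  fix \<gamma>
  have "\<zeta> - \<gamma> + (\<zeta> - \<gamma>) < \<zeta> \<longleftrightarrow> \<zeta> < \<gamma> + \<gamma>"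
    by (metis add.commute add_diff_eq diff_less_eq add_less_cancel_left diff_add_eq)
  then show "Poly_Mapping.lookup (upper_half \<zeta> (gflip \<zeta> f)) \<gamma> =
      Poly_Mapping.lookup (gflip \<zeta> (lower_half \<zeta> f)) \<gamma>"
    by (simp add: upper_half.rep_eq lower_half.rep_eq lookup_gflip)
qed

lemma lower_half_eq_self:
  assumes "gdeg f + gdeg f < Fin \<zeta>"
  shows "lower_half \<zeta> f = f"
proof (rule poly_mapping_eqI)
  fix \<gamma>
  show "Poly_Mapping.lookup (lower_half \<zeta> f) \<gamma> = Poly_Mapping.lookup f \<gamma>"
  proof (cases "\<gamma> \<in> Poly_Mapping.keys f")
    case True
    then have "\<gamma> \<le> Max (Poly_Mapping.keys f)" "f \<noteq> 0" by auto
    moreover from this have "Max (Poly_Mapping.keys f) + Max (Poly_Mapping.keys f) < \<zeta>"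
      using assms by (simp add: gdeg_def)
    ultimately have "\<gamma> + \<gamma> < \<zeta>"
      using add_mono le_less_trans by blast
    then show ?thesis by (simp add: lower_half.rep_eq)
  qed (simp add: lower_half.rep_eq in_keys_iff)
qed

section \<open>Sums over chains\<close>

text \<open>Multichains may repeat entries and so form infinite sets, over which a plain
  \<open>sum\<close> is 0 by convention; finiteness of the support is therefore part of the
  predicate.\<close>

definition has_fin_sum :: "('a \<Rightarrow> 'b::comm_monoid_add) \<Rightarrow> 'a set \<Rightarrow> 'b \<Rightarrow> bool" where
  "has_fin_sum f X s \<longleftrightarrow> finite {a \<in> X. f a \<noteq> 0} \<and> (\<Sum>a | a \<in> X \<and> f a \<noteq> 0. f a) = s"

lemma has_fin_sum_support:
  assumes "finite Y" "Y \<subseteq> X" "\<And>a. a \<in> X - Y \<Longrightarrow> f a = 0" "sum f Y = s"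
  shows "has_fin_sum f X s"
proof -
  have sub: "{a \<in> X. f a \<noteq> 0} \<subseteq> Y" using assms(3) by auto
  then have "finite {a \<in> X. f a \<noteq> 0}" using assms(1) finite_subset by blast
  moreover have "sum f {a \<in> X. f a \<noteq> 0} = sum f Y"
    using sub assms(1,2) by (intro sum.mono_neutral_left) auto
  ultimately show ?thesis using assms(4) by (simp add: has_fin_sum_def)
qed

lemma has_fin_sum_zero: "(\<And>a. a \<in> X \<Longrightarrow> f a = 0) \<Longrightarrow> has_fin_sum f X 0"
  by (rule has_fin_sum_support[of "{}"]) auto

lemma has_fin_sum_singleton: "has_fin_sum f {a} (f a)"
  by (rule has_fin_sum_support[of "{a}"]) auto

lemma has_fin_sum_Un:
  assumes "has_fin_sum f X s" "has_fin_sum f Y t" "X \<inter> Y = {}"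
  shows "has_fin_sum f (X \<union> Y) (s + t)"
proof (rule has_fin_sum_support[of "{a \<in> X. f a \<noteq> 0} \<union> {a \<in> Y. f a \<noteq> 0}"])
  show "sum f ({a \<in> X. f a \<noteq> 0} \<union> {a \<in> Y. f a \<noteq> 0}) = s + t"
    using assms unfolding has_fin_sum_def by (subst sum.union_disjoint) auto
qed (use assms in \<open>auto simp: has_fin_sum_def\<close>)

lemma has_fin_sum_UN:
  assumes "finite I" "\<And>i. i \<in> I \<Longrightarrow> has_fin_sum f (X i) (s i)"
    and "\<And>i j. i \<in> I \<Longrightarrow> j \<in> I \<Longrightarrow> i \<noteq> j \<Longrightarrow> X i \<inter> X j = {}"
  shows "has_fin_sum f (\<Union>i\<in>I. X i) (\<Sum>i\<in>I. s i)"
  using assms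
proof (induction I rule: finite_induct)
  case (insert i I)
  have "has_fin_sum f (\<Union>i\<in>I. X i) (\<Sum>i\<in>I. s i)"
    using insert.prems by (intro insert.IH) auto
  moreover have "X i \<inter> X j = {}" if "j \<in> I" for j
    using insert.prems(2)[of i j] insert.hyps(2) that by auto
  ultimately have "has_fin_sum f (X i \<union> (\<Union>i\<in>I. X i)) (s i + (\<Sum>i\<in>I. s i))"
    using insert.prems(1) by (intro has_fin_sum_Un) auto
  then show ?case using insert by simp
qed (auto intro: has_fin_sum_zero)

text \<open>Intended for \<open>h = (#) x\<close> and \<open>F\<close> the additive effect on
  \<open>scrR\<close> of putting \<open>x\<close> in front.\<close>

lemma has_fin_sum_image:
  assumes "has_fin_sum f X s" "inj_on h X" "\<And>a. a \<in> X \<Longrightarrow> f (h a) = F (f a)"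
    and F: "F 0 = 0" "\<And>a b. F (a + b) = F a + F b"
  shows "has_fin_sum f (h ` X) (F s)"
proof (rule has_fin_sum_support[of "h ` {a \<in> X. f a \<noteq> 0}"])
  let ?Y = "{a \<in> X. f a \<noteq> 0}"
  have F_sum: "F (sum f Y) = (\<Sum>a\<in>Y. F (f a))" for Y
    by (induction Y rule: infinite_finite_induct) (simp_all add: F)
  have "inj_on h ?Y" using assms(2) by (rule inj_on_subset) auto
  then have "sum f (h ` ?Y) = (\<Sum>a\<in>?Y. F (f a))"
    using assms(3) by (auto simp: sum.reindex intro!: sum.cong)
  then show "sum f (h ` ?Y) = F s"
    using assms(1) F_sum[of ?Y] by (simp add: has_fin_sum_def)
qed (use assms in \<open>auto simp: has_fin_sum_def\<close>)

lemma has_fin_sum_finite: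
  assumes "has_fin_sum f X s" "finite X"
  shows "sum f X = s"
proof -
  have "sum f {a \<in> X. f a \<noteq> 0} = sum f X"
    using assms(2) by (intro sum.mono_neutral_left) auto
  then show ?thesis using assms(1) by (simp add: has_fin_sum_def)
qed

context coxeter_system
begin

section \<open>Decomposing chains by their first step\<close>

lemma chains_of_tranclp:
  assumes "xs \<in> chains_of r E k x y"
  shows "tranclp r x y"
  using assms
proof (induction xs arbitrary: k x)
  case (Cons a xs)
  then obtain b zs where [simp]: "a = x" "xs = b # zs" and r: "r x b"
    by (cases xs) (auto simp: chains_of_def)
  show ?case
  proof (cases zs)
    case Nil
    then show ?thesis using Cons.prems r by (auto simp: chains_of_def)
  next
    case (Cons c ws)
    then have "xs \<in> chains_of r E (k - 1) b y"
      using Cons.prems by (auto simp: chains_of_def)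
    then show ?thesis using Cons.IH r by (meson tranclp_into_tranclp2)
  qed
qed (simp add: chains_of_def)

text \<open>The split is by the second entry \<open>t\<close>. Restricting to
  \<open>tranclp r t y\<close> loses nothing, since otherwise there is no chain from
  \<open>t\<close> to \<open>y\<close>, and it makes the index set a Bruhat interval in the
  applications.\<close>

lemma UN_chains_of_unfold:
  assumes "x \<in> E" "y \<in> E"
  shows "(\<Union>k. chains_of r E k x y) =
    (if r x y then {[x, y]} else {}) \<union>
    (\<Union>t \<in> {t \<in> E. r x t \<and> tranclp r t y}. (#) x ` (\<Union>k. chains_of r E k t y))"
  (is "?A = ?B \<union> ?C")
proof (intro equalityI subsetI)
  fix xs assume "xs \<in> ?A"
  then obtain k where k: "xs \<in> chains_of r E k x y" by blast
  then obtain t zs where xs: "xs = x # t # zs"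
    by (cases xs; cases "tl xs") (auto simp: chains_of_def)
  show "xs \<in> ?B \<union> ?C"
  proof (cases zs)
    case Nil
    then show ?thesis using k xs by (auto simp: chains_of_def)
  next
    case (Cons c ws)
    then have t: "t # zs \<in> chains_of r E (k - 1) t y" "t \<in> E" "r x t"
      using k xs by (auto simp: chains_of_def)
    then show ?thesis using chains_of_tranclp[OF t(1)] xs by blast
  qed
next
  fix xs assume "xs \<in> ?B \<union> ?C"
  then show "xs \<in> ?A"
  proof
    assume "xs \<in> ?B"
    then have "xs \<in> chains_of r E 0 x y"
      using assms by (auto simp: chains_of_def split: if_splits)
    then show ?thesis by blast
  next
    assume "xs \<in> ?C"
    then obtain t zs k where "xs = x # zs" "r x t" "zs \<in> chains_of r E k t y" by blast
    then have "xs \<in> chains_of r E (Suc k) x y"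
      using assms by (cases zs) (auto simp: chains_of_def)
    then show ?thesis by blast
  qed
qed

lemma tranclp_bruhat_le: "tranclp bruhat_le x y \<longleftrightarrow> bruhat_le x y"
proof -
  have "transp bruhat_le"
    using bruhat_le_trans by (blast intro: transpI)
  then show ?thesis by (simp add: trancl_id[to_pred])
qed

lemma tranclp_bruhat_less: "tranclp bruhat_less x y \<longleftrightarrow> bruhat_less x y"
proof -
  have "transp bruhat_less"
    by (rule transpI) (metis bruhat_less_def bruhat_le_trans bruhat_le_antisym)
  then show ?thesis by (simp add: trancl_id[to_pred])
qed

lemma multichains_unfold:
  assumes "x \<in> E" "y \<in> E" "bruhat_le x y"
  shows "multichains E x y = insert [x, y]
    (\<Union>t \<in> {t \<in> E. bruhat_le x t \<and> bruhat_le t y}. (#) x ` multichains E t y)"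
  using UN_chains_of_unfold[OF assms(1,2), of bruhat_le] assms(3)
  by (simp add: multichains_def tranclp_bruhat_le)

lemma chains_unfold:
  assumes "x \<in> E" "y \<in> E" "bruhat_less x y"
  shows "chains E x y = insert [x, y]
    (\<Union>t \<in> {t \<in> E. bruhat_less x t \<and> bruhat_less t y}. (#) x ` chains E t y)"
  using UN_chains_of_unfold[OF assms(1,2), of bruhat_less] assms(3)
  by (simp add: chains_def tranclp_bruhat_less)

lemma chains_of_shape:
  assumes "xs \<in> chains_of r E k x y"
  obtains z zs where "xs = x # z # zs" "last (z # zs) = y"
  using assms by (cases xs; cases "tl xs") (auto simp: chains_of_def)

lemma chains_hd: "xs \<in> chains E x y \<Longrightarrow> hd xs = x"
  and multichains_hd: "xs \<in> multichains E x y \<Longrightarrow> hd xs = x"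
  and chains_length: "xs \<in> chains E x y \<Longrightarrow> 2 \<le> length xs"
  and multichains_length: "xs \<in> multichains E x y \<Longrightarrow> 2 \<le> length xs"
  by (auto simp: chains_def multichains_def chains_of_def)

end

context W_graph_ideal
begin

section \<open>Putting an element in front of a chain\<close>

lemma scrR_two_eq_gflip: "scrR_two x y = gflip (L y - L x) (Rpoly x y)"
  by (simp add: scrR_two_def gflip_def flip: qpow_add)

text \<open>The recursion step of \<open>scrR\<close> as an operator on the value \<open>f\<close>
  of the tail. It depends on the tail only through its end points \<open>t\<close> and
  \<open>y\<close> and is additive in \<open>f\<close>, so it applies to whole sums over
  chains.\<close>

definition extend_chain :: "'w \<Rightarrow> 'w \<Rightarrow> 'w \<Rightarrow> 'g gring \<Rightarrow> 'g gring" where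
  "extend_chain y x t f = scrR_two x t * upper_half (L y - L t) (gflip (L y - L t) f)"

lemma extend_chain_zero: "extend_chain y x t 0 = 0"
  by (simp add: extend_chain_def)

lemma extend_chain_add: "extend_chain y x t (f + g) = extend_chain y x t f + extend_chain y x t g"
  by (simp add: extend_chain_def gflip_add upper_half_add distrib_left)

lemma scrR_Cons:
  assumes "zs \<in> chains_of r E k t y"
  shows "scrR (x # zs) = extend_chain y x t (scrR zs)"
proof -
  obtain z ws where "zs = t # z # ws" "last (z # ws) = y"
    using chains_of_shape[OF assms] .
  then show ?thesis
    by (simp add: extend_chain_def gflip_def flip: qpow_add)
qed

lemma scrR_Cons_chains: "zs \<in> chains E t y \<Longrightarrow> scrR (x # zs) = extend_chain y x t (scrR zs)"
  and scrR_Cons_multichains: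
    "zs \<in> multichains E t y \<Longrightarrow> scrR (x # zs) = extend_chain y x t (scrR zs)"
  unfolding chains_def multichains_def by (auto intro: scrR_Cons)

end

section \<open>The recursion for the Kazhdan-Lusztig polynomials\<close>

locale W_graph_ideal_KL = W_graph_ideal +
  fixes P
  assumes KL: "KL_family P"
begin

lemma KL_diag: "x \<in> E \<Longrightarrow> P x x = 1"
  using KL by (simp add: KL_family_def)

lemma KL_lower:
  assumes "x \<in> E" "y \<in> E" "bruhat_less x y"
  shows "lower_half (L y - L x) (P x y) = P x y"
  using KL assms by (intro lower_half_eq_self) (simp add: KL_family_def)

lemma KL_equation:
  assumes "x \<in> E" "y \<in> E"
  shows "gflip (L y - L x) (P x y) =
    (\<Sum>t | t \<in> E \<and> bruhat_le x t \<and> bruhat_le t y. Rpoly x t * P t y)"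
  using KL assms by (simp add: KL_family_def gflip_def flip: qpow_add)

lemma scrR_two_diag:
  assumes "x \<in> E"
  shows "scrR_two x x = 1"
proof -
  have "{t. t \<in> E \<and> bruhat_le x t \<and> bruhat_le t x} = {x}"
    using assms bruhat_le_antisym by auto
  then have "Rpoly x x = 1"
    using KL_equation[OF assms assms] by (simp add: KL_diag assms gflip_one)
  then show ?thesis by (simp add: scrR_two_eq_gflip gflip_one)
qed

lemma finite_interval: "finite {t \<in> E. Q t \<and> bruhat_le t y}"
  by (rule finite_subset[OF _ finite_bruhat_le[of y]]) auto

lemma finite_strict_interval: "finite {t \<in> E. Q t \<and> bruhat_less t y}"
  by (rule finite_subset[OF _ finite_bruhat_le[of y]]) (auto simp: bruhat_less_def)

text \<open>The defining relation reflected once more, with the end points split off: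
  \<open>t = x\<close> gives the reflected \<open>P x y\<close> because
  \<open>scrR_two x x = 1\<close>, and \<open>t = y\<close> gives \<open>scrR_two x y\<close>
  because \<open>P y y = 1\<close>.\<close>

lemma KL_recursion:
  assumes "x \<in> E" "y \<in> E" "bruhat_less x y"
  shows "P x y = gflip (L y - L x) (P x y) + scrR_two x y +
    (\<Sum>t | t \<in> E \<and> bruhat_less x t \<and> bruhat_less t y. scrR_two x t * gflip (L y - L t) (P t y))"
proof -
  let ?q = "\<lambda>t. scrR_two x t * gflip (L y - L t) (P t y)"
  let ?I = "{t \<in> E. bruhat_less x t \<and> bruhat_less t y}"
  have "P x y = gflip (L y - L x) (\<Sum>t | t \<in> E \<and> bruhat_le x t \<and> bruhat_le t y. Rpoly x t * P t y)"
    by (simp flip: KL_equation[OF assms(1,2)])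
  also have "\<dots> = (\<Sum>t | t \<in> E \<and> bruhat_le x t \<and> bruhat_le t y. ?q t)"
    unfolding gflip_sum
  proof (rule sum.cong[OF refl])
    fix t
    show "gflip (L y - L x) (Rpoly x t * P t y) = ?q t"
      using gflip_mult[of "L t - L x" "L y - L t" "Rpoly x t" "P t y"]
      by (simp add: scrR_two_eq_gflip)
  qed
  also have "{t. t \<in> E \<and> bruhat_le x t \<and> bruhat_le t y} = insert x (insert y ?I)"
    using assms bruhat_le_refl by (auto simp: bruhat_less_def)
  also have "sum ?q \<dots> = ?q x + (?q y + sum ?q ?I)"
    using assms(3) finite_strict_interval[of "bruhat_less x" y] by (simp add: bruhat_less_def)
  finally show ?thesis
    using assms by (simp add: scrR_two_diag KL_diag gflip_one add.assoc)
qed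

text \<open>By the degree bound the reflected \<open>P t y\<close> lies entirely in the upper half,
  so the truncation does not change it.\<close>

lemma extend_chain_KL:
  assumes "t \<in> E" "y \<in> E" "bruhat_less t y"
  shows "extend_chain y x t (P t y) = scrR_two x t * gflip (L y - L t) (P t y)"
  using assms by (simp add: extend_chain_def upper_half_gflip KL_lower)

text \<open>Here the truncation point is 0, and the strict inequality discards the constant
  1.\<close>

lemma extend_chain_KL_diag: "y \<in> E \<Longrightarrow> extend_chain y x y (P y y) = 0"
  by (simp add: extend_chain_def KL_diag gflip_one upper_half_one)

lemma lower_half_gflip_KL:
  assumes "x \<in> E" "y \<in> E" "bruhat_less x y"
  shows "lower_half (L y - L x) (gflip (L y - L x) (P x y)) = 0"
  using assms by (metis KL_lower lower_half_upper_half upper_half_gflip)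

text \<open>The subtracted term reflects back to \<open>P t y\<close>, which the upper truncation
  kills. Hence the strict chain sum and \<open>P t y\<close> itself have the same extension.\<close>

lemma extend_chain_diff_gflip:
  assumes "t \<in> E" "y \<in> E" "bruhat_less t y"
  shows "extend_chain y x t (P t y - gflip (L y - L t) (P t y)) =
    scrR_two x t * gflip (L y - L t) (P t y)"
  using assms
  by (simp add: extend_chain_def upper_half_gflip lower_half_diff KL_lower lower_half_gflip_KL)

section \<open>Summation over chains and multichains\<close>

lemma chains_sum:
  assumes "x \<in> E" "y \<in> E" "bruhat_less x y"
  shows "finite (chains E x y) \<and>
    has_fin_sum scrR (chains E x y) (P x y - gflip (L y - L x) (P x y))"
  using assms
proof (induction "len y - len x" arbitrary: x rule: less_induct)
  case less
  let ?I = "{t \<in> E. bruhat_less x t \<and> bruhat_less t y}"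
  have IH: "finite (chains E t y)"
    "has_fin_sum scrR (chains E t y) (P t y - gflip (L y - L t) (P t y))" if "t \<in> ?I" for t
    using less.hyps[of t] less.prems that bruhat_less_len[of x t] bruhat_less_len[of t y] by auto
  have fin: "finite (chains E x y)"
    using IH finite_strict_interval[of "bruhat_less x" y] by (simp add: chains_unfold[OF less.prems])
  have "has_fin_sum scrR (\<Union>t\<in>?I. (#) x ` chains E t y)
      (\<Sum>t\<in>?I. extend_chain y x t (P t y - gflip (L y - L t) (P t y)))"
    using finite_strict_interval
    by (intro has_fin_sum_UN has_fin_sum_image IH)
      (auto simp: scrR_Cons_chains extend_chain_zero extend_chain_add dest!: chains_hd)
  \<comment> \<open>The two sets are disjoint because the tail of \<open>[x, y]\<close> has one
    entry, whereas chains have at least two.\<close>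
  then have "has_fin_sum scrR ({[x, y]} \<union> (\<Union>t\<in>?I. (#) x ` chains E t y))
      (scrR [x, y] + (\<Sum>t\<in>?I. extend_chain y x t (P t y - gflip (L y - L t) (P t y))))"
    by (intro has_fin_sum_Un has_fin_sum_singleton) (auto dest!: chains_length)
  also have "(\<Sum>t\<in>?I. extend_chain y x t (P t y - gflip (L y - L t) (P t y))) =
      (\<Sum>t\<in>?I. scrR_two x t * gflip (L y - L t) (P t y))"
    using less.prems by (intro sum.cong) (simp_all add: extend_chain_diff_gflip)
  also have "scrR [x, y] + \<dots> = P x y - gflip (L y - L x) (P x y)"
    using KL_recursion[OF less.prems] by (simp add: algebra_simps)
  finally show ?case
    using fin by (simp add: chains_unfold[OF less.prems])
qed

text \<open>
  For \<open>x < y\<close> and \<open>\<zeta> = L y - L x\<close>: multichains that do not repeat \<open>x\<close> at the start sum to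
  \<open>P x y - gflip \<zeta> (P x y)\<close>, those that repeat it once sum to \<open>gflip \<zeta> (P x y)\<close>, and every
  multichain that repeats it twice contributes \<open>0\<close>, since the two truncations are then
  complementary.
\<close>

lemma multichains_sum:
  assumes "x \<in> E" "y \<in> E" "bruhat_le x y"
  shows "has_fin_sum scrR (multichains E x y) (P x y)"
  using assms
proof (induction "len y - len x" arbitrary: x rule: less_induct)
  case less
  let ?\<zeta> = "L y - L x"
  let ?M = "multichains E x y"
  let ?I = "{t \<in> E. bruhat_less x t \<and> bruhat_le t y}"
  \<comment> \<open>Besides \<open>[x, y]\<close>, these are the multichains whose second entry
    differs from \<open>x\<close>. For \<open>x = y\<close> the index set \<open>?I\<close> is empty
    and only \<open>[x, x]\<close> remains.\<close>
  let ?B = "insert [x, y] (\<Union>t\<in>?I. (#) x ` multichains E t y)"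
  let ?c = "scrR_two x y + (\<Sum>t\<in>?I. extend_chain y x t (P t y))"
  have IH: "has_fin_sum scrR (multichains E t y) (P t y)" if "t \<in> ?I" for t
  proof -
    have "len x < len t" "len t \<le> len y"
      using that bruhat_less_len[of x t] bruhat_less_len[of t y]
      by (auto simp: bruhat_less_def intro: order.strict_implies_order)
    then show ?thesis using less that by auto
  qed
  have "has_fin_sum scrR (\<Union>t\<in>?I. (#) x ` multichains E t y)
      (\<Sum>t\<in>?I. extend_chain y x t (P t y))"
    using finite_interval
    by (intro has_fin_sum_UN has_fin_sum_image IH)
      (auto simp: scrR_Cons_multichains extend_chain_zero extend_chain_add dest!: multichains_hd)
  then have "has_fin_sum scrR ({[x, y]} \<union> (\<Union>t\<in>?I. (#) x ` multichains E t y)) (scrR [x, y] +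
      (\<Sum>t\<in>?I. extend_chain y x t (P t y)))"
    by (intro has_fin_sum_Un has_fin_sum_singleton) (auto dest!: multichains_length)
  then have B: "has_fin_sum scrR ?B ?c" by simp

  have "{t \<in> E. bruhat_le x t \<and> bruhat_le t y} = insert x ?I"
    using less.prems by (auto simp: bruhat_less_def)
  from multichains_unfold[OF less.prems, unfolded this]
  have "?M = insert [x, y] (\<Union>t\<in>insert x ?I. (#) x ` multichains E t y)" .
  also have "\<dots> = ?B \<union> (#) x ` ?M"
    by auto
  finally have M: "?M = ?B \<union> (#) x ` ?M" .
  \<comment> \<open>The induction hypothesis does not reach \<open>t = x\<close>. Instead the
    decomposition \<open>M\<close> is substituted into itself, leaving a remainder with
    \<open>x\<close> put in front twice.\<close>
  from arg_cong[OF M, of "(`) ((#) x)"]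
  have xM: "(#) x ` ?M = (#) x ` ?B \<union> (#) x ` (#) x ` ?M"
    unfolding image_Un .
  have M3: "?M = ?B \<union> ((#) x ` ?B \<union> (#) x ` (#) x ` ?M)"
    unfolding xM[symmetric] by (rule M)
  have "?B \<subseteq> ?M" using M by blast
  have xB: "has_fin_sum scrR ((#) x ` ?B) (extend_chain y x x ?c)"
    using \<open>?B \<subseteq> ?M\<close>
    by (intro has_fin_sum_image[OF B])
      (auto simp: extend_chain_zero extend_chain_add intro!: scrR_Cons_multichains)
  have xxM: "has_fin_sum scrR ((#) x ` (#) x ` ?M) 0"
  proof (rule has_fin_sum_zero)
    fix zs assume "zs \<in> (#) x ` (#) x ` ?M"
    then obtain ws where ws: "zs = x # x # ws" "ws \<in> ?M" by blast
    moreover from ws(2) have "x # ws \<in> ?M" using M by blast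
    \<comment> \<open>The outer upper truncation of a reflection becomes a reflected lower
      truncation and meets the inner upper truncation at the same point.\<close>
    ultimately show "scrR zs = 0"
      using less.prems
      by (simp add: scrR_Cons_multichains extend_chain_def scrR_two_diag
          upper_half_gflip[of _ "upper_half _ _"] lower_half_upper_half)
  qed
  have disj: "?B \<inter> (#) x ` ?M = {}"
  proof (intro equals0I)
    fix zs assume "zs \<in> ?B \<inter> (#) x ` ?M"
    then obtain ws where ws: "zs = x # ws" "ws \<in> ?M" "zs \<in> ?B" by blast
    \<comment> \<open>In \<open>?B\<close> a tail is either \<open>[y]\<close>, which is too short,
      or starts with some \<open>t \<noteq> x\<close>.\<close>
    then have "hd ws = x" "2 \<le> length ws"
      by (auto dest: multichains_hd multichains_length)
    with ws show False
      by (auto simp: bruhat_less_def dest: multichains_hd)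
  qed
  have "has_fin_sum scrR (?B \<union> ((#) x ` ?B \<union> (#) x ` (#) x ` ?M)) (?c + (extend_chain y x x ?c + 0))"
  proof (intro has_fin_sum_Un B xB xxM)
    show "(#) x ` ?B \<inter> (#) x ` (#) x ` ?M = {}"
      unfolding image_Int[OF inj_on_Cons1, symmetric] disj by simp
    show "?B \<inter> ((#) x ` ?B \<union> (#) x ` (#) x ` ?M) = {}"
      unfolding xM[symmetric] by (rule disj)
  qed
  then have sum: "has_fin_sum scrR ?M (?c + extend_chain y x x ?c)"
    unfolding M3[symmetric] by simp
  have "?c + extend_chain y x x ?c = P x y"
  proof (cases "x = y")
    case True
    then have I: "?I = {}"
      using bruhat_le_antisym by (auto simp: bruhat_less_def)
    have "?c = P y y"
      unfolding I using True less.prems by (simp add: scrR_two_diag KL_diag)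
    then show ?thesis
      using True less.prems by (simp add: extend_chain_KL_diag)
  next
    case False
    then have xy: "bruhat_less x y" using less.prems by (simp add: bruhat_less_def)
    let ?K = "{t \<in> E. bruhat_less x t \<and> bruhat_less t y}"
    \<comment> \<open>Unlike the index set of \<open>KL_recursion\<close>, \<open>?I\<close>
      contains \<open>y\<close>; its term vanishes by \<open>extend_chain_KL_diag\<close>.\<close>
    have "?I = insert y ?K"
      using less.prems xy by (auto simp: bruhat_less_def)
    then have "(\<Sum>t\<in>?I. extend_chain y x t (P t y)) =
        extend_chain y x y (P y y) + (\<Sum>t\<in>?K. extend_chain y x t (P t y))"
      using finite_strict_interval[of "bruhat_less x" y] by (simp add: bruhat_less_def)
    also have "\<dots> = (\<Sum>t\<in>?K. scrR_two x t * gflip (L y - L t) (P t y))"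
      using less.prems by (simp add: extend_chain_KL_diag extend_chain_KL)
    finally have c: "?c = P x y - gflip ?\<zeta> (P x y)"
      using KL_recursion[OF less.prems(1,2) xy] by (simp add: algebra_simps)
    \<comment> \<open>Extending \<open>?c\<close> by a repeated \<open>x\<close> gives exactly the
      reflected \<open>P x y\<close> that \<open>?c\<close> lacks.\<close>
    show ?thesis
      unfolding c using less.prems xy
      by (simp add: extend_chain_diff_gflip scrR_two_diag)
  qed
  with sum show ?case by simp
qed

text \<open>The chain sum is \<open>P x y\<close> minus its reflection; these lie strictly on
  opposite sides of the truncation point.\<close>

lemma KL_eq_lower_half_chains:
  assumes "x \<in> E" "y \<in> E" "bruhat_less x y"
  shows "P x y = lower_half (L y - L x) (\<Sum>\<phi>\<in>chains E x y. scrR \<phi>)"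
proof -
  have "(\<Sum>\<phi>\<in>chains E x y. scrR \<phi>) = P x y - gflip (L y - L x) (P x y)"
    using chains_sum[OF assms] has_fin_sum_finite by blast
  then show ?thesis
    using assms by (simp add: lower_half_diff KL_lower lower_half_gflip_KL)
qed

end

theorem theorem5p9:
  fixes G :: "('w, 'x) monoid_scheme"
    and S E J :: "'w set"
    and L :: "'w \<Rightarrow> 'g::linordered_ab_group_add"
    and hscale :: "'g gring \<Rightarrow> 'h::ring_1 \<Rightarrow> 'h"
    and T :: "'w \<Rightarrow> 'h" and hbar :: "'h \<Rightarrow> 'h"
    and mscale :: "'g gring \<Rightarrow> 'm::ab_group_add \<Rightarrow> 'm"
    and act :: "'h \<Rightarrow> 'm \<Rightarrow> 'm" and Gam :: "'w \<Rightarrow> 'm" and mbar :: "'m \<Rightarrow> 'm"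
    and P :: "'w \<Rightarrow> 'w \<Rightarrow> 'g gring"
    and x y :: 'w
  assumes "W_graph_ideal G S L hscale T hbar mscale E J act Gam mbar"
    and "W_graph_ideal.KL_family G S L mscale E Gam mbar P"
    and "x \<in> E" and "y \<in> E"
  shows "(coxeter_system.bruhat_less G S x y \<longrightarrow>
      finite (coxeter_system.chains G S E x y) \<and>
      P x y = lower_half (L y - L x)
        (\<Sum>\<phi> \<in> coxeter_system.chains G S E x y.
           W_graph_ideal.scrR G S L mscale E Gam mbar \<phi>)) \<and>
    (coxeter_system.bruhat_le G S x y \<longrightarrow>
      finite {\<phi> \<in> coxeter_system.multichains G S E x y.
        W_graph_ideal.scrR G S L mscale E Gam mbar \<phi> \<noteq> 0} \<and>
      P x y =
        (\<Sum>\<phi> | \<phi> \<in> coxeter_system.multichains G S E x y \<and>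
                 W_graph_ideal.scrR G S L mscale E Gam mbar \<phi> \<noteq> 0.
           W_graph_ideal.scrR G S L mscale E Gam mbar \<phi>))"
proof -
  interpret W_graph_ideal_KL G S L hscale T hbar mscale E J act Gam mbar P
    using assms(1,2) by (simp add: W_graph_ideal_KL_def W_graph_ideal_KL_axioms_def)
  show ?thesis
    using chains_sum[OF assms(3,4)] KL_eq_lower_half_chains[OF assms(3,4)]
      multichains_sum[OF assms(3,4)]
    by (auto simp: has_fin_sum_def)
qed

end
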